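(* For all positive integers $d\le n$, \begin{equation*} \sum_{j=0}^{\lfloor \frac{d-1}2\rfloor} \frac{ (2^{2n-2j}-1)B_{2n-2j} }{2^{2d-1} d} \binom{2d-2j-2}{d-1} \binom{2n}{2j} =\frac{(-1)^{d+1}}{4^n}\sum_{\ell =0}^{n-d} \binom{n-\ell}{d}\binom{2n}{2\ell}E_{2\ell}. \end{equation*} Further, for positive integers $n<d$ (where binomial coefficients $\binom{2n}{2j}$ with $j>n$ are $0$), \begin{equation*} \sum_{j=0}^{\lfloor \frac{d-1}2\rfloor} \frac{ (2^{2n-2j}-1)B_{2n-2j} }{2^{2d-1} d} \binom{2d-2j-2}{d-1} \binom{2n}{2j} = \begin{cases} 0, & \text{if } n<d<2n,\\[2pt] \displaystyle \frac{n}{2^{2d-1} d} \binom{2d-2n-1}{d-1} , & \text{if } d\ge 2n. \end{cases} \end{equation*}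
   Context: The Bernoulli numbers $B_j$ are defined by $\frac{x}{e^x-1}=\sum_{j\ge0}B_j\frac{x^j}{j!}$. The Euler numbers $E_{2j}$ are defined by $\sec x=\sum_{j\ge0}(-1)^jE_{2j}\frac{x^{2j}}{(2j)!}$. *)

theory Defs
  imports Complex_Main "HOL-Computational_Algebra.Formal_Power_Series"
begin

definition bernoulli :: "nat \<Rightarrow> real" where
  "bernoulli j = fact j * fps_nth (fps_X / (fps_exp 1 - 1)) j"

text \<open>
  Only even indices carry information: sec is even, so \<open>euler_num j = 0\<close> for odd \<open>j\<close>.
\<close>
definition euler_num :: "nat \<Rightarrow> real" where
  "euler_num j = (-1) ^ (j div 2) * fact j * fps_nth (inverse (fps_cos 1)) j"

text \<open>
  The denominator \<open>fps_exp 1 - 1\<close> has vanishing constant coefficient, so it is not a unit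
  of the ring of formal power series; the division is nevertheless exact.
\<close>
lemma bernoulli_egf:
  "Abs_fps (\<lambda>j. bernoulli j / fact j) * (fps_exp 1 - 1) = fps_X"
proof -
  let ?E = "fps_exp 1 - 1 :: real fps"
  have ne: "?E \<noteq> 0"
  proof
    assume "?E = 0"
    then have "fps_nth ?E 1 = 0" by simp
    then show False by simp
  qed
  have sub: "subdegree ?E = 1"
    by (rule subdegreeI) auto
  have "Abs_fps (\<lambda>j. bernoulli j / fact j) = fps_X / ?E"
    by (simp add: fps_eq_iff bernoulli_def)
  moreover have "?E dvd fps_X"
    using ne sub by (simp add: fps_dvd_iff)
  ultimately show ?thesis by simp
qed

lemma euler_num_egf:
  "Abs_fps (\<lambda>j. (-1) ^ (j div 2) * euler_num j / fact j) * fps_cos 1 = 1"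
proof -
  have "Abs_fps (\<lambda>j. (-1) ^ (j div 2) * euler_num j / fact j) = inverse (fps_cos 1)"
    by (simp add: fps_eq_iff euler_num_def mult.assoc flip: power_add mult_2)
  then show ?thesis by (simp add: inverse_mult_eq_1 fps_cos_def)
qed

end

theory Submission
  imports Defs
begin

text \<open>
  With \<open>c = 1 / (2 ^ (2 * d - 1) * d)\<close>, the left-hand side is \<open>(2 * n)!\<close> times the coefficient of
  \<open>x ^ (2 * n)\<close> in \<open>(x / 2) * tanh (x / 2) * P(x)\<close>, where \<open>P\<close> is an even polynomial with coefficients
  \<open>c * ((2 * d - 2 * j - 2) choose (d - 1)) / (2 * j)!\<close>. The right-hand sides together are the
  same coefficient of \<open>R(x) + (-1) ^ (d + 1) * sech (x / 2) * F(x)\<close>, where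
  \<open>F(x) = (\<Sum>m. (m choose d) * (x / 2) ^ (2 * m) / (2 * m)!)\<close> and \<open>R\<close> is the even polynomial with
  coefficients \<open>c * n * ((2 * d - 2 * n - 1) choose (d - 1)) / (2 * n)!\<close> for \<open>2 * n \<le> d\<close>.
  After multiplication by \<open>cosh (x / 2)\<close> this no longer involves Bernoulli or Euler numbers, and
  comparing coefficients leaves the binomial identity
  \<open>(\<Sum>k\<le>e. (-2) ^ k * ((2 * M + 1) choose k) * ((2 * e - k) choose e)) = (-4) ^ e * (M choose e)\<close>
  for \<open>e = d - 1\<close>, in which even \<open>k\<close> come from \<open>P\<close> and odd \<open>k\<close> from \<open>R\<close>.
\<close>

section \<open>The alternating binomial sum as a power series coefficient\<close>

lemma fps_nth_one_plus_linear_power: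
  fixes c :: "'a::comm_ring_1"
  shows "fps_nth ((1 + fps_const c * fps_X) ^ m) k = of_nat (m choose k) * c ^ k"
proof (induction m arbitrary: k)
  case 0
  then show ?case by (cases k) auto
next
  case (Suc m)
  have "fps_nth ((1 + fps_const c * fps_X) ^ Suc m) k
      = of_nat (m choose k) * c ^ k
        + c * (if k = 0 then 0 else of_nat (m choose (k - 1)) * c ^ (k - 1))"
    by (simp add: distrib_right mult.assoc Suc.IH)
  then show ?case
    by (cases k) (simp_all add: algebra_simps)
qed

text \<open>\<open>W e\<close> is the series of (1 - x) to the power -(e + 1); on coefficients the
  relation is Pascal's rule.\<close>

lemma one_minus_fps_X_times_binomial_series:
  fixes W :: "nat \<Rightarrow> 'a::comm_ring_1 fps"
  defines "W \<equiv> \<lambda>e. Abs_fps (\<lambda>k. of_nat ((e + k) choose e))"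
  shows "(1 - fps_X) * W (Suc e) = W e"
proof (rule fps_ext)
  fix k
  show "fps_nth ((1 - fps_X) * W (Suc e)) k = fps_nth (W e) k"
    by (cases k) (simp_all add: W_def left_diff_distrib binomial_eq_0)
qed

text \<open>By the symmetry of row 2 * e - 1, both summands of the central coefficient are equal.
  The guard matters at e = 0, where truncated subtraction would give 0 choose 0 = 1.\<close>

lemma binomial_double_minus:
  "(of_nat ((2 * e) choose e) :: 'a::comm_ring_1)
     - 2 * of_nat (if e = 0 then 0 else (2 * e - 1) choose e) = (if e = 0 then 1 else 0)"
proof (cases e)
  case (Suc f)
  have "(2 * e) choose e = ((2 * f + 1) choose f) + ((2 * f + 1) choose Suc f)"
    using Suc by simp
  moreover have "(2 * f + 1) choose f = (2 * f + 1) choose Suc f"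
    using binomial_symmetric[of f "2 * f + 1"] by simp
  ultimately show ?thesis using Suc by (simp add: algebra_simps)
qed simp

text \<open>The sum is the coefficient of \<open>y ^ e\<close> in \<open>(1 - 2 * y) ^ (2 * M + 1) / (1 - y) ^ (e + 1)\<close>;
  since \<open>(1 - 2 * y)\<^sup>2 = 1 - 4 * y * (1 - y)\<close>, these coefficients obey Pascal's rule up to powers
  of \<open>-4\<close>.\<close>
lemma alternating_binomial_sum:
  "(\<Sum>k\<le>e. (- 2) ^ k * of_nat ((2 * M + 1) choose k) * of_nat ((2 * e - k) choose e))
     = (- 4 :: 'a::comm_ring_1) ^ e * of_nat (M choose e)"
proof -
  define W :: "nat \<Rightarrow> 'a fps" where "W = (\<lambda>e. Abs_fps (\<lambda>k. of_nat ((e + k) choose e)))"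
  define L :: "'a fps" where "L = 1 + fps_const (- 2) * fps_X"
  have W: "(1 - fps_X) * W (Suc e) = W e" for e
    unfolding W_def by (rule one_minus_fps_X_times_binomial_series)
  have L: "L = 1 - 2 * fps_X"
    by (rule fps_ext) (simp add: L_def numeral_fps_const)
  have "fps_nth (L ^ (2 * M + 1) * W e) e = (- 4) ^ e * of_nat (M choose e)"
  proof (induction M arbitrary: e)
    case 0
    have "fps_nth (L * W e) e = fps_nth (W e) e - 2 * fps_nth (fps_X * W e) e"
      by (simp add: L left_diff_distrib mult.assoc numeral_fps_const)
    also have "\<dots> = of_nat ((2 * e) choose e) - 2 * of_nat (if e = 0 then 0 else (2 * e - 1) choose e)"
      by (cases e) (simp_all add: W_def flip: mult_2)
    also have "\<dots> = (if e = 0 then 1 else 0)"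
      by (rule binomial_double_minus)
    finally show ?case by (cases e) auto
  next
    case (Suc M)
    show ?case
    proof (cases e)
      case 0
      then show ?thesis by (simp add: L W_def fps_nth_power_0)
    next
      case (Suc f)
      have "L ^ (2 * Suc M + 1) = L ^ (2 * M + 1) * L\<^sup>2"
        by (simp add: power2_eq_square mult_ac)
      also have "L\<^sup>2 = 1 - 4 * (fps_X * (1 - fps_X))"
        by (simp add: L power2_eq_square algebra_simps)
      finally have step: "L ^ (2 * Suc M + 1) = L ^ (2 * M + 1) * (1 - 4 * (fps_X * (1 - fps_X)))" .
      have "L ^ (2 * Suc M + 1) * W e
          = L ^ (2 * M + 1) * W e - 4 * (fps_X * (L ^ (2 * M + 1) * ((1 - fps_X) * W e)))"
        unfolding step by (simp only: left_diff_distrib right_diff_distrib mult_ac mult_1_left)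
      also have "(1 - fps_X) * W e = W f"
        using W Suc by simp
      finally have "fps_nth (L ^ (2 * Suc M + 1) * W e) e
          = fps_nth (L ^ (2 * M + 1) * W e) e - 4 * fps_nth (L ^ (2 * M + 1) * W f) f"
        using Suc by (simp add: numeral_fps_const)
      then show ?thesis
        by (simp only: Suc.IH) (simp add: Suc algebra_simps)
    qed
  qed
  moreover have "fps_nth (L ^ (2 * M + 1) * W e) e
      = (\<Sum>k\<le>e. (- 2) ^ k * of_nat ((2 * M + 1) choose k) * of_nat ((2 * e - k) choose e))"
    unfolding fps_mult_nth L_def fps_nth_one_plus_linear_power atLeast0AtMost
    by (rule sum.cong) (simp_all add: W_def mult_2 mult_2_right mult_ac)
  ultimately show ?thesis by simp
qed

section \<open>Even series and binomial convolution\<close>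

lemma sum_atMost_double:
  fixes f :: "nat \<Rightarrow> 'a::comm_monoid_add"
  assumes "\<And>i. odd i \<Longrightarrow> f i = 0"
  shows "sum f {..2 * n} = (\<Sum>j\<le>n. f (2 * j))"
  using assms by (induction n) simp_all

lemma fps_mult_nth_even:
  fixes A B :: "'a::comm_ring_1 fps"
  assumes "\<And>i. odd i \<Longrightarrow> fps_nth A i = 0"
  shows "fps_nth (A * B) (2 * n) = (\<Sum>j\<le>n. fps_nth A (2 * j) * fps_nth B (2 * (n - j)))"
  unfolding fps_mult_nth atLeast0AtMost
  by (subst sum_atMost_double) (simp_all add: assms diff_mult_distrib2)

lemma fps_mult_nth_odd:
  fixes A B :: "'a::comm_ring_1 fps"
  assumes "\<And>i. odd i \<Longrightarrow> fps_nth A i = 0" "\<And>i. odd i \<Longrightarrow> fps_nth B i = 0" "odd n"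
  shows "fps_nth (A * B) n = 0"
  unfolding fps_mult_nth
proof (rule sum.neutral, safe)
  fix i assume "i \<in> {0..n}"
  then show "fps_nth A i * fps_nth B (n - i) = 0"
    using assms by (cases "odd i") auto
qed

text \<open>The factorial is that of the full exponent 2 * n, so that products convolve with the
  weights \<open>(2 * n) choose (2 * j)\<close>.\<close>

definition even_egf :: "(nat \<Rightarrow> real) \<Rightarrow> real fps" where
  "even_egf a = Abs_fps (\<lambda>k. if even k then a (k div 2) / fact k else 0)"

lemma even_egf_nth [simp]:
  "fps_nth (even_egf a) (2 * n) = a n / fact (2 * n)"
  "odd k \<Longrightarrow> fps_nth (even_egf a) k = 0"
  by (simp_all add: even_egf_def)

text \<open>One even factor suffices, since it selects the even coefficients of \<open>B\<close>. So
  \<open>B\<close> can be a series such as \<open>genocchi_fps\<close> whose evenness is not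
  established.\<close>

lemma fps_nth_even_egf_mult:
  "fps_nth (even_egf a * B) (2 * n) * fact (2 * n)
   = (\<Sum>j\<le>n. real ((2 * n) choose (2 * j)) * a j * (fact (2 * (n - j)) * fps_nth B (2 * (n - j))))"
  by (subst fps_mult_nth_even)
     (auto simp: sum_distrib_right binomial_fact diff_mult_distrib2 intro!: sum.cong)

lemma even_egf_mult:
  "even_egf a * even_egf b
     = even_egf (\<lambda>n. \<Sum>j\<le>n. real ((2 * n) choose (2 * j)) * a j * b (n - j))"
proof (rule fps_ext)
  fix k
  show "fps_nth (even_egf a * even_egf b) k =
      fps_nth (even_egf (\<lambda>n. \<Sum>j\<le>n. real ((2 * n) choose (2 * j)) * a j * b (n - j))) k"
  proof (cases "even k")
    case True
    then obtain n where "k = 2 * n" by (elim evenE)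
    then show ?thesis
      using fps_nth_even_egf_mult[of a "even_egf b" n] by (simp add: nonzero_eq_divide_eq)
  qed (simp add: fps_mult_nth_odd)
qed


lemma even_egf_add: "even_egf a + even_egf b = even_egf (\<lambda>n. a n + b n)"
  by (rule fps_ext) (simp add: even_egf_def add_divide_distrib)

lemma even_egf_one: "even_egf (\<lambda>n. if n = 0 then 1 else 0) = 1"
  by (rule fps_ext) (auto simp: even_egf_def elim!: evenE)

section \<open>The binomial identity in rows of even index\<close>

lemma sum_even_odd_split:
  fixes f :: "nat \<Rightarrow> 'a::comm_monoid_add"
  shows "sum f {..2 * n + 1} = (\<Sum>j\<le>n. f (2 * j)) + (\<Sum>j\<le>n. f (2 * j + 1))"
  by (induction n) (simp_all add: ac_simps)

lemma two_power_double:
  "(2 :: 'a::comm_ring_1) ^ (2 * b) = 4 ^ b" "(2 :: 'a) ^ (b * 2) = 4 ^ b"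
  "(- 2 :: 'a) ^ (2 * b) = 4 ^ b" "(- 2 :: 'a) ^ (b * 2) = 4 ^ b"
  by (simp_all add: power_mult mult.commute[of b])

text \<open>For N = M + 1 this is \<open>alternating_binomial_sum\<close> times 2 * N. Absorption
  turns row 2 * M + 1 into row 2 * N: even k = 2 * j give the left side, odd k = 2 * j - 1 carry a
  negative sign and move to the right. For N = 0 all terms vanish.\<close>

lemma alternating_binomial_sum_even_form:
  "(\<Sum>j\<le>N. real ((2 * N) choose (2 * j))
        * (4 ^ j * real (if 2 * j \<le> e then (2 * e - 2 * j) choose e else 0)) * real (2 * (N - j)))
   = (\<Sum>j\<le>N. real ((2 * N) choose (2 * j))
        * (4 ^ j * real (if 2 * j \<le> e + 1 then j * ((2 * e + 1 - 2 * j) choose e) else 0)))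
     + 2 * (- 4) ^ e * real (e + 1) * real (N choose (e + 1))"
proof (cases N)
  case (Suc M)
  \<comment> \<open>The cutoff permits summation over the whole row, also for e = 0, where truncated
    subtraction would make 0 choose 0 = 1 of the terms beyond e.\<close>
  define g where "g = (\<lambda>k. real (if k \<le> e then (2 * e - k) choose e else 0))"
  define f where "f = (\<lambda>k. (- 2) ^ k * real ((2 * M + 1) choose k) * g k)"
  have "sum f {..2 * M + 1} = (\<Sum>k\<le>e. (- 2) ^ k * real ((2 * M + 1) choose k) * real ((2 * e - k) choose e))"
    unfolding f_def g_def by (rule sum.mono_neutral_cong) (auto simp: not_le binomial_eq_0)
  also have "\<dots> = (- 4) ^ e * real (M choose e)"
    by (rule alternating_binomial_sum)
  finally have key: "(\<Sum>j\<le>M. f (2 * j)) + (\<Sum>j\<le>M. f (2 * j + 1)) = (- 4) ^ e * real (M choose e)"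
    by (simp only: sum_even_odd_split)
  have even_terms: "real (2 * M + 2) * f (2 * j)
      = real ((2 * N) choose (2 * j)) * (4 ^ j * g (2 * j)) * real (2 * (N - j))" if "j \<le> M" for j
  proof -
    have "(2 * N - 2 * j) * ((2 * N) choose (2 * j)) = 2 * N * ((2 * M + 1) choose (2 * j))"
      using binomial_absorb_comp[of "2 * N" "2 * j"] Suc by simp
    then have "real (2 * (N - j)) * real ((2 * N) choose (2 * j)) = real (2 * M + 2) * real ((2 * M + 1) choose (2 * j))"
      using Suc by (simp only: flip: of_nat_mult) (simp add: diff_mult_distrib2)
    then show ?thesis
      by (simp add: f_def two_power_double mult_ac)
  qed
  have odd_terms: "real (2 * M + 2) * f (2 * j + 1)
      = - (real ((2 * N) choose (2 * Suc j)) * (4 ^ Suc j * (real (Suc j) * g (2 * j + 1))))" for j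
  proof -
    have "(2 * Suc j) * ((2 * N) choose (2 * Suc j)) = 2 * N * ((2 * M + 1) choose (2 * j + 1))"
      using Suc_times_binomial[of "2 * j + 1" "2 * M + 1"] Suc by simp
    then have "real (2 * Suc j) * real ((2 * N) choose (2 * Suc j)) = real (2 * M + 2) * real ((2 * M + 1) choose (2 * j + 1))"
      using Suc by (simp only: flip: of_nat_mult) simp
    moreover have "real (2 * M + 2) * f (2 * j + 1)
        = - (2 * 4 ^ j * g (2 * j + 1) * (real (2 * M + 2) * real ((2 * M + 1) choose (2 * j + 1))))"
      by (simp add: f_def two_power_double mult_ac)
    ultimately have "real (2 * M + 2) * f (2 * j + 1)
        = - (2 * 4 ^ j * g (2 * j + 1) * (real (2 * Suc j) * real ((2 * N) choose (2 * Suc j))))"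
      by (simp only:)
    moreover have "- (2 * p * x * (2 * q * y)) = - (y * (4 * p * (q * x)))" for p q x y :: real
      by simp
    ultimately show ?thesis
      by (simp only: power_Suc of_nat_mult of_nat_numeral)
  qed
  have g_Suc: "real (if 2 * Suc j \<le> e + 1 then Suc j * ((2 * e + 1 - 2 * Suc j) choose e) else 0)
      = real (Suc j) * g (2 * j + 1)" for j
    by (auto simp: g_def algebra_simps)
  have even_sum: "(\<Sum>j\<le>N. real ((2 * N) choose (2 * j)) * (4 ^ j * g (2 * j)) * real (2 * (N - j)))
      = real (2 * M + 2) * (\<Sum>j\<le>M. f (2 * j))"
  proof -
    have "(\<Sum>j\<le>N. real ((2 * N) choose (2 * j)) * (4 ^ j * g (2 * j)) * real (2 * (N - j)))
        = (\<Sum>j\<le>M. real ((2 * N) choose (2 * j)) * (4 ^ j * g (2 * j)) * real (2 * (N - j)))"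
      by (rule sum.mono_neutral_right) (auto simp: Suc le_Suc_eq)
    also have "\<dots> = (\<Sum>j\<le>M. real (2 * M + 2) * f (2 * j))"
      by (rule sum.cong) (simp_all only: even_terms atMost_iff)
    finally show ?thesis
      by (simp only: sum_distrib_left)
  qed
  have odd_sum: "(\<Sum>j\<le>N. real ((2 * N) choose (2 * j)) * (4 ^ j * real (if 2 * j \<le> e + 1 then j * ((2 * e + 1 - 2 * j) choose e) else 0)))
      = - (real (2 * M + 2) * (\<Sum>j\<le>M. f (2 * j + 1)))"
    \<comment> \<open>The summand j = 0 vanishes through its factor j; the others are reindexed by
      \<open>Suc j\<close>.\<close>
    unfolding sum_distrib_left odd_terms sum_negf minus_minus
    unfolding Suc sum.atMost_Suc_shift g_Suc by simp
  have rhs: "2 * (- 4) ^ e * real (e + 1) * real (N choose (e + 1))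
      = real (2 * M + 2) * ((- 4) ^ e * real (M choose e))"
  proof -
    have "real (e + 1) * real (N choose (e + 1)) = real (M + 1) * real (M choose e)"
      using arg_cong[OF Suc_times_binomial[of e M], of real] by (simp only: of_nat_mult Suc Suc_eq_plus1)
    then have "2 * (- 4) ^ e * real (e + 1) * real (N choose (e + 1))
        = 2 * (- 4) ^ e * (real (M + 1) * real (M choose e))"
      by (simp only: mult.assoc)
    also have "\<dots> = real (2 * M + 2) * ((- 4) ^ e * real (M choose e))"
      by simp
    finally show ?thesis .
  qed
  have g_even: "real (if 2 * j \<le> e then (2 * e - 2 * j) choose e else 0) = g (2 * j)" for j
    by (simp add: g_def)
  show ?thesis
    unfolding g_even even_sum odd_sum rhs key[symmetric] by (simp only: distrib_left)
qed simp

section \<open>Hyperbolic series for the Bernoulli and Euler numbers\<close>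

text \<open>The next two series are \<open>cosh (x / 2)\<close> and \<open>(x / 2) * sinh (x / 2)\<close>.\<close>
definition half_cosh :: "real fps" where
  "half_cosh = even_egf (\<lambda>n. 1 / 4 ^ n)"

definition half_X_sinh :: "real fps" where
  "half_X_sinh = even_egf (\<lambda>n. real (2 * n) / 4 ^ n)"

lemma half_cosh_exp: "2 * half_cosh = fps_exp (1 / 2) + fps_exp (- (1 / 2))"
  by (rule fps_ext)
     (auto simp: half_cosh_def even_egf_def numeral_fps_const two_power_double power_divide field_simps
           elim!: evenE oddE)

lemma half_X_sinh_exp: "4 * half_X_sinh = fps_X * (fps_exp (1 / 2) - fps_exp (- (1 / 2)))"
proof (rule fps_ext)
  fix k
  show "fps_nth (4 * half_X_sinh) k = fps_nth (fps_X * (fps_exp (1 / 2) - fps_exp (- (1 / 2)))) k"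
  proof (cases k)
    case (Suc m)
    show ?thesis
    proof (cases "even k")
      case True
      then obtain b where b: "m = 2 * b + 1"
        using Suc by (auto elim: oddE)
      then have k: "k = 2 * Suc b" "2 * Suc b = Suc m" and "odd m"
        using Suc by simp_all
      have "fps_nth (4 * half_X_sinh) k = 4 * (real (2 * Suc b) / 4 ^ Suc b / fact (2 * Suc b))"
        by (simp only: k(1) half_X_sinh_def numeral_fps_const fps_mult_left_const_nth even_egf_nth)
      also have "\<dots> = 4 / (4 ^ Suc b * fact m)"
        unfolding k(2) by (simp add: field_simps del: of_nat_Suc)
      also have "\<dots> = 2 * (1 / 2) ^ m / fact m"
        by (simp add: b power_divide two_power_double)
      also have "\<dots> = fps_nth (fps_X * (fps_exp (1 / 2) - fps_exp (- (1 / 2)))) k"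
        using \<open>odd m\<close> by (simp add: Suc)
      finally show ?thesis .
    qed (simp add: half_X_sinh_def even_egf_def numeral_fps_const Suc)
  qed (simp add: half_X_sinh_def even_egf_def)
qed

text \<open>The summand \<open>x / 2\<close> cancels the contribution of \<open>B\<^sub>1\<close>, which turns \<open>- x / (exp x + 1)\<close> into
  \<open>(x / 2) * tanh (x / 2)\<close>.\<close>
definition genocchi_fps :: "real fps" where
  "genocchi_fps = Abs_fps (\<lambda>m. (2 ^ m - 1) * bernoulli m / fact m) + fps_const (1 / 2) * fps_X"

lemma genocchi_fps_times_half_cosh: "genocchi_fps * half_cosh = half_X_sinh"
proof -
  define B where "B = Abs_fps (\<lambda>j. bernoulli j / fact j)"
  define B2 where "B2 = Abs_fps (\<lambda>j. 2 ^ j * (bernoulli j / fact j))"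
  define E :: "real fps" where "E = fps_exp (1 / 2)"
  define E' :: "real fps" where "E' = fps_exp (- (1 / 2))"
  have EE': "E * E' = 1"
    by (simp add: E_def E'_def flip: fps_exp_add_mult)
  have E2: "E\<^sup>2 = fps_exp 1"
    by (simp add: E_def power2_eq_square flip: fps_exp_add_mult)
  have E4: "E ^ 4 = fps_exp 2"
    by (simp add: E_def fps_exp_power_mult)
  have B: "B * (E\<^sup>2 - 1) = fps_X"
    unfolding B_def E2 by (rule bernoulli_egf)
  have "B2 * (fps_exp 2 - 1) = fps_const 2 * fps_X"
  proof -
    let ?l = "fps_const 2 * fps_X :: real fps"
    \<comment> \<open>\<open>B2\<close> is B(2 * x), so its equation comes from that of
      \<open>B\<close> by substituting 2 * x.\<close>
    have "(B * (fps_exp 1 - 1)) oo ?l = (B oo ?l) * ((fps_exp 1 - 1) oo ?l)"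
      by (rule fps_compose_mult_distrib) simp
    moreover have "B oo ?l = B2"
      by (simp add: fps_compose_linear B_def B2_def)
    moreover have "(fps_exp 1 - 1) oo ?l = fps_exp 2 - 1"
      by (rule fps_ext) (simp only: fps_compose_linear, simp add: right_diff_distrib)
    moreover have "fps_X oo ?l = ?l"
      by simp
    ultimately show ?thesis
      using B E2 by simp
  qed
  then have B2: "B2 * (E ^ 4 - 1) = 2 * fps_X"
    by (simp add: E4 numeral_fps_const)
  have T: "2 * genocchi_fps = 2 * B2 - 2 * B + fps_X"
    by (rule fps_ext)
       (simp add: genocchi_fps_def B_def B2_def numeral_fps_const algebra_simps diff_divide_distrib)
  have "E\<^sup>2 - 1 \<noteq> 0"
  proof
    assume "E\<^sup>2 - 1 = 0"
    then have "fps_nth (fps_exp 1 - 1 :: real fps) 1 = 0" by (simp add: E2)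
    then show False by simp
  qed
  \<comment> \<open>The factor \<open>E\<^sup>2 - 1\<close> makes the equations for \<open>B\<close>
    and \<open>B2\<close> applicable without division; being nonzero, it cancels afterwards.\<close>
  moreover have "(E\<^sup>2 - 1) * (2 * genocchi_fps * (E\<^sup>2 + 1) - fps_X * (E\<^sup>2 - 1))
      = 2 * (B2 * (E ^ 4 - 1)) - 2 * (B * (E\<^sup>2 - 1)) * (E\<^sup>2 + 1)
        + fps_X * (E ^ 4 - 1) - fps_X * (E\<^sup>2 - 1)\<^sup>2"
    unfolding T by algebra
  moreover have "\<dots> = 0"
    unfolding B B2 by algebra
  ultimately have "2 * genocchi_fps * (E\<^sup>2 + 1) = fps_X * (E\<^sup>2 - 1)"
    by simp
  \<comment> \<open>Multiplying by the inverse of \<open>E\<close> turns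
    \<open>E\<^sup>2 + 1\<close> into \<open>E + E'\<close> and \<open>E\<^sup>2 - 1\<close> into
    \<open>E - E'\<close>.\<close>
  then have "E' * (2 * genocchi_fps * (E\<^sup>2 + 1)) = E' * (fps_X * (E\<^sup>2 - 1))"
    by simp
  then have "2 * genocchi_fps * (E + E') = fps_X * (E - E')"
    using EE' by algebra
  then have "4 * (genocchi_fps * half_cosh) = 4 * half_X_sinh"
    unfolding half_X_sinh_exp E_def E'_def using half_cosh_exp by algebra
  then show ?thesis by simp
qed

text \<open>This is sec times cos = 1, read as a convolution: the signs combine to
  \<open>(- 1) ^ n\<close> and drop out, which passes to sech and cosh, and the powers of 4 likewise
  rescale x to x / 2.\<close>

lemma half_sech: "half_cosh * even_egf (\<lambda>l. euler_num (2 * l) / 4 ^ l) = 1"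
proof -
  let ?A = "Abs_fps (\<lambda>j. (- 1) ^ (j div 2) * euler_num j / fact j)"
  have cos: "fps_cos 1 = even_egf (\<lambda>n. (- 1) ^ n)"
    by (rule fps_ext) (simp add: fps_cos_def even_egf_def)
  have "(\<Sum>j\<le>n. real ((2 * n) choose (2 * j)) * euler_num (2 * (n - j))) = (if n = 0 then 1 else 0)" for n
  proof -
    have "(\<Sum>j\<le>n. real ((2 * n) choose (2 * j)) * (- 1) ^ j * ((- 1) ^ (n - j) * euler_num (2 * (n - j))))
        = fps_nth (even_egf (\<lambda>n. (- 1) ^ n) * ?A) (2 * n) * fact (2 * n)"
      unfolding fps_nth_even_egf_mult by simp
    also have "even_egf (\<lambda>n. (- 1) ^ n) * ?A = 1"
      using euler_num_egf by (simp add: cos mult.commute)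
    also have "(\<Sum>j\<le>n. real ((2 * n) choose (2 * j)) * (- 1) ^ j * ((- 1) ^ (n - j) * euler_num (2 * (n - j))))
        = (- 1) ^ n * (\<Sum>j\<le>n. real ((2 * n) choose (2 * j)) * euler_num (2 * (n - j)))"
      unfolding sum_distrib_left
    proof (rule sum.cong)
      fix j assume "j \<in> {..n}"
      then have "(- 1 :: real) ^ n = (- 1) ^ j * (- 1) ^ (n - j)"
        by (simp flip: power_add)
      then show "real ((2 * n) choose (2 * j)) * (- 1) ^ j * ((- 1) ^ (n - j) * euler_num (2 * (n - j)))
          = (- 1) ^ n * (real ((2 * n) choose (2 * j)) * euler_num (2 * (n - j)))"
        by (simp only: mult_ac)
    qed simp
    finally show ?thesis by (cases "n = 0") auto
  qed
  moreover have "(\<Sum>j\<le>n. real ((2 * n) choose (2 * j)) * (1 / 4 ^ j) * (euler_num (2 * (n - j)) / 4 ^ (n - j)))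
      = (\<Sum>j\<le>n. real ((2 * n) choose (2 * j)) * euler_num (2 * (n - j))) / 4 ^ n" for n
    unfolding sum_divide_distrib by (rule sum.cong) (simp_all flip: power_add)
  ultimately show ?thesis
    unfolding half_cosh_def even_egf_mult even_egf_one[symmetric]
    by (intro arg_cong[where f = even_egf] ext) simp
qed


section \<open>The series identity and its coefficients\<close>

lemma genocchi_fps_mult_even_egf:
  assumes "1 \<le> d"
  defines "c \<equiv> 1 / (2 ^ (2 * d - 1) * real d)"
  shows "genocchi_fps
        * even_egf (\<lambda>j. c * real (if 2 * j < d then (2 * d - 2 * j - 2) choose (d - 1) else 0))
      = even_egf (\<lambda>j. c * real (if 2 * j \<le> d then j * ((2 * d - 2 * j - 1) choose (d - 1)) else 0))
        + even_egf (\<lambda>l. euler_num (2 * l) / 4 ^ l) * even_egf (\<lambda>m. (- 1) ^ (d + 1) * real (m choose d) / 4 ^ m)"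
    (is "_ * even_egf ?p = even_egf ?r + ?H * even_egf ?f")
proof -
  obtain e where d: "d = Suc e"
    using assms by (cases d) auto
  \<comment> \<open>The normalization \<open>c\<close> reduces the last term of
    \<open>alternating_binomial_sum_even_form\<close> to a sign.\<close>
  have c: "c * (2 * (- 4) ^ e * real (e + 1)) = (- 1) ^ (d + 1)"
  proof -
    have "(- 4 :: real) ^ e = (- 1) ^ e * 4 ^ e"
      by (simp flip: power_mult_distrib)
    moreover have "(2 :: real) ^ (2 * d - 1) = 2 * 4 ^ e"
      by (simp add: d two_power_double)
    ultimately show ?thesis
      by (simp add: c_def d)
  qed
  have scale: "c / 4 ^ N * (\<Sum>j\<le>N. real ((2 * N) choose (2 * j)) * (4 ^ j * u j) * v (N - j))
      = (\<Sum>j\<le>N. real ((2 * N) choose (2 * j)) * (c * u j) * (v (N - j) / 4 ^ (N - j)))" for N u v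
    unfolding sum_distrib_left by (rule sum.cong) (simp_all add: power_diff)
  have "even_egf ?p * half_X_sinh = even_egf ?r * half_cosh + even_egf ?f"
    unfolding half_X_sinh_def half_cosh_def even_egf_mult even_egf_add
  proof (intro arg_cong[where f = even_egf] ext)
    fix N
    have p: "?p j = c * real (if 2 * j \<le> e then (2 * e - 2 * j) choose e else 0)" for j
      by (simp add: d less_Suc_eq_le)
    have r: "?r j = c * real (if 2 * j \<le> e + 1 then j * ((2 * e + 1 - 2 * j) choose e) else 0)" for j
      by (simp add: d Suc_diff_le)
    have f: "?f N = c / 4 ^ N * (2 * (- 4) ^ e * real (e + 1) * real (N choose (e + 1)))"
      using c by (simp add: d flip: mult.assoc)
    show "(\<Sum>j\<le>N. real ((2 * N) choose (2 * j)) * ?p j * (real (2 * (N - j)) / 4 ^ (N - j)))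
        = (\<Sum>j\<le>N. real ((2 * N) choose (2 * j)) * ?r j * (1 / 4 ^ (N - j))) + ?f N"
      using arg_cong[OF alternating_binomial_sum_even_form[of N e], of "\<lambda>x. c / 4 ^ N * x"]
      unfolding p r f distrib_left
      using scale[where v = "\<lambda>_. 1"] scale[where v = "\<lambda>k. real (2 * k)"]
      by (simp only: mult_1_right)
  qed
  moreover have "half_cosh * ?H = 1"
    by (rule half_sech)
  ultimately show ?thesis
    \<comment> \<open>Multiplying the previous equation by \<open>?H\<close> removes
      \<open>half_cosh\<close> on both sides.\<close>
    using genocchi_fps_times_half_cosh by algebra
qed

theorem theorem3p1:
  fixes n d :: nat
  assumes "1 \<le> n" and "1 \<le> d"
  shows
    "(d \<le> n \<longrightarrow>
       (\<Sum>j = 0..(d - 1) div 2.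
          (2 ^ (2 * n - 2 * j) - 1) * bernoulli (2 * n - 2 * j) / (2 ^ (2 * d - 1) * real d)
          * real ((2 * d - 2 * j - 2) choose (d - 1)) * real ((2 * n) choose (2 * j)))
       = (-1) ^ (d + 1) / 4 ^ n
         * (\<Sum>l = 0..n - d.
              real ((n - l) choose d) * real ((2 * n) choose (2 * l)) * euler_num (2 * l)))
     \<and>
     (n < d \<longrightarrow>
       (\<Sum>j = 0..(d - 1) div 2.
          (2 ^ (2 * n - 2 * j) - 1) * bernoulli (2 * n - 2 * j) / (2 ^ (2 * d - 1) * real d)
          * real ((2 * d - 2 * j - 2) choose (d - 1)) * real ((2 * n) choose (2 * j)))
       = (if d < 2 * n then 0
          else real n / (2 ^ (2 * d - 1) * real d) * real ((2 * d - 2 * n - 1) choose (d - 1))))"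
proof -
  define c where "c = 1 / (2 ^ (2 * d - 1) * real d)"
  let ?p = "\<lambda>j. c * real (if 2 * j < d then (2 * d - 2 * j - 2) choose (d - 1) else 0)"
  let ?r = "\<lambda>j. c * real (if 2 * j \<le> d then j * ((2 * d - 2 * j - 1) choose (d - 1)) else 0)"
  let ?f = "\<lambda>m. (- 1) ^ (d + 1) * real (m choose d) / 4 ^ m"
  let ?h = "\<lambda>l. euler_num (2 * l) / 4 ^ l"
  let ?B = "\<lambda>j. (2 ^ (2 * n - 2 * j) - 1) * bernoulli (2 * n - 2 * j) / (2 ^ (2 * d - 1) * real d)
          * real ((2 * d - 2 * j - 2) choose (d - 1)) * real ((2 * n) choose (2 * j))"
  let ?E = "\<lambda>l. real ((n - l) choose d) * real ((2 * n) choose (2 * l)) * euler_num (2 * l)"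
  have "genocchi_fps * even_egf ?p = even_egf ?r + even_egf ?h * even_egf ?f"
    unfolding c_def by (rule genocchi_fps_mult_even_egf) fact
  then have "fps_nth (even_egf ?p * genocchi_fps) (2 * n) * fact (2 * n)
      = (fps_nth (even_egf ?r) (2 * n) + fps_nth (even_egf ?h * even_egf ?f) (2 * n)) * fact (2 * n)"
    by (simp add: mult.commute)
  moreover have "fps_nth (even_egf ?p * genocchi_fps) (2 * n) * fact (2 * n) = (\<Sum>j = 0..(d - 1) div 2. ?B j)"
  proof -
    \<comment> \<open>The summand x / 2 of \<open>genocchi_fps\<close> lives at index 1, outside the
      even indices.\<close>
    have "fact (2 * (n - j)) * fps_nth genocchi_fps (2 * (n - j))
        = (2 ^ (2 * n - 2 * j) - 1) * bernoulli (2 * n - 2 * j)" for j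
      by (simp add: genocchi_fps_def diff_mult_distrib2)
    \<comment> \<open>The ranges differ in zero terms only: \<open>?p j\<close> is 0 for j > (d - 1)
      div 2, and the binomial coefficient is 0 for j > n.\<close>
    then show ?thesis
      unfolding fps_nth_even_egf_mult
      by (intro sum.mono_neutral_cong) (use assms in \<open>auto simp: c_def binomial_eq_0\<close>)
  qed
  moreover have "fps_nth (even_egf ?h * even_egf ?f) (2 * n) * fact (2 * n)
      = (- 1) ^ (d + 1) / 4 ^ n * (\<Sum>l\<le>n. ?E l)"
    unfolding fps_nth_even_egf_mult sum_distrib_left
    by (rule sum.cong) (simp_all add: power_diff)
  moreover have "fps_nth (even_egf ?r) (2 * n) * fact (2 * n) = ?r n"
    by simp
  ultimately have main: "(\<Sum>j = 0..(d - 1) div 2. ?B j) = ?r n + (- 1) ^ (d + 1) / 4 ^ n * (\<Sum>l\<le>n. ?E l)"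
    by (simp only: distrib_right)
  show ?thesis
  proof (intro conjI impI)
    assume "d \<le> n"
    then have "(\<Sum>l\<le>n. ?E l) = (\<Sum>l = 0..n - d. ?E l)"
      by (intro sum.mono_neutral_right) (auto simp: binomial_eq_0)
    \<comment> \<open>Here \<open>?r n\<close> is 0, because d \<le> n < 2 * n.\<close>
    then show "(\<Sum>j = 0..(d - 1) div 2. ?B j) = (- 1) ^ (d + 1) / 4 ^ n * (\<Sum>l = 0..n - d. ?E l)"
      using main \<open>d \<le> n\<close> assms by simp
  next
    assume "n < d"
    \<comment> \<open>Now n - l < d for every l, so only \<open>?r n\<close> remains, and its cutoff
      gives the two cases.\<close>
    then have "(\<Sum>l\<le>n. ?E l) = 0"
      by (intro sum.neutral) (auto simp: binomial_eq_0)
    then show "(\<Sum>j = 0..(d - 1) div 2. ?B j) = (if d < 2 * n then 0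
          else real n / (2 ^ (2 * d - 1) * real d) * real ((2 * d - 2 * n - 1) choose (d - 1)))"
      using main by (simp add: c_def)
  qed
qed

end
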